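(* Any solution $(a,b)$, defined on all of $\mathbb R$, of $$\frac{d}{dt}\left(\frac{\dot a(t)}{\sqrt{1-\dot a(t)^2}}\right)=\frac{\kappa_a}{2}\left[\frac{\rho(\dot b(t_2^-))}{(a(t)-b(t_2^-))^2}+\frac{\sigma(\dot b(t_2^+))}{(a(t)-b(t_2^+))^2}\right],$$ $$\frac{d}{dt}\left(\frac{\dot b(t)}{\sqrt{1-\dot b(t)^2}}\right)=-\frac{\kappa_b}{2}\left[\frac{\sigma(\dot a(t_1^-))}{(b(t)-a(t_1^-))^2}+\frac{\rho(\dot a(t_1^+))}{(b(t)-a(t_1^+))^2}\right]$$ (with $t_i^\pm=t_i^\pm(a,b,t)$) is uniquely determined by the trajectory strips $a|_{[T_1^-,T_1^+]}$ and $b|_{[T_2^-,T_2^+]}$, where $T_1^+\in\mathbb R$ is arbitrary and $T_2^+=t_2^+(a,b,T_1^+)$, $T_2^-=t_2^-(a,b,T_1^+)$, $T_1^-=t_1^-(a,b,T_2^-)$. That is: if $(a,b)$ and $(\tilde a,\tilde b)$ are two solutions, $T_1^+\in\mathbb R$, the times $T_2^\pm$, $T_1^-$ are defined from $(a,b)$ and $T_1^+$ as stated, and $\tilde a=a$ on $[T_1^-,T_1^+]$ and $\tilde b=b$ on $[T_2^-,T_2^+]$, then $\tilde a=a$ and $\tilde b=b$ on $\mathbb R$.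
   Context: Two like charges (charges $e_a,e_b$ of equal sign, masses $m_a,m_b>0$) move on a straight line; $\kappa_a=e_ae_b/m_a>0$ and $\kappa_b=e_ae_b/m_b>0$ are fixed coupling constants. The speed of light is $1$. Set $\rho(v)=\frac{1+v}{1-v}$, $\sigma(v)=\frac{1-v}{1+v}$ for $v\in\,]-1,1[$. For trajectories $a,b:\mathbb R\to\mathbb R$, the advanced ($+$) and retarded ($-$) times are defined implicitly by $$t_1^\pm(a,b,t)=t\pm|a(t_1^\pm(a,b,t))-b(t)|,\qquad t_2^\pm(a,b,t)=t\pm|a(t)-b(t_2^\pm(a,b,t))|.$$ A solution is a pair $a,b\in C^2(\mathbb R)$ with $|\dot a(t)|,|\dot b(t)|<1$ and $a(t)>b(t)$ for all $t$, for which all the advanced and retarded times exist and the two equations hold for all $t\in\mathbb R$. *)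

theory Defs
  imports "HOL-Analysis.Analysis"
begin

definition rho :: "real \<Rightarrow> real" where
  "rho v = (1 + v) / (1 - v)"

definition sigma :: "real \<Rightarrow> real" where
  "sigma v = (1 - v) / (1 + v)"

(* The advanced and retarded times are given implicitly.  When both speeds are below 1,
   each of the four equations has at most one solution, so the description operator picks
   the solution whenever there is one; existence is required separately in
   all_light_times_exist. *)

definition t1_adv :: "(real \<Rightarrow> real) \<Rightarrow> (real \<Rightarrow> real) \<Rightarrow> real \<Rightarrow> real" where
  "t1_adv a b t = (THE s. s = t + \<bar>a s - b t\<bar>)"

definition t1_ret :: "(real \<Rightarrow> real) \<Rightarrow> (real \<Rightarrow> real) \<Rightarrow> real \<Rightarrow> real" where
  "t1_ret a b t = (THE s. s = t - \<bar>a s - b t\<bar>)"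

definition t2_adv :: "(real \<Rightarrow> real) \<Rightarrow> (real \<Rightarrow> real) \<Rightarrow> real \<Rightarrow> real" where
  "t2_adv a b t = (THE s. s = t + \<bar>a t - b s\<bar>)"

definition t2_ret :: "(real \<Rightarrow> real) \<Rightarrow> (real \<Rightarrow> real) \<Rightarrow> real \<Rightarrow> real" where
  "t2_ret a b t = (THE s. s = t - \<bar>a t - b s\<bar>)"

definition all_light_times_exist :: "(real \<Rightarrow> real) \<Rightarrow> (real \<Rightarrow> real) \<Rightarrow> bool" where
  "all_light_times_exist a b \<longleftrightarrow>
     (\<forall>t. (\<exists>s. s = t + \<bar>a s - b t\<bar>) \<and> (\<exists>s. s = t - \<bar>a s - b t\<bar>) \<and>
          (\<exists>s. s = t + \<bar>a t - b s\<bar>) \<and> (\<exists>s. s = t - \<bar>a t - b s\<bar>))"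

definition C2 :: "(real \<Rightarrow> real) \<Rightarrow> bool" where
  "C2 f \<longleftrightarrow> f C1_differentiable_on UNIV \<and> deriv f C1_differentiable_on UNIV"

definition solution ::
    "real \<Rightarrow> real \<Rightarrow> (real \<Rightarrow> real) \<Rightarrow> (real \<Rightarrow> real) \<Rightarrow> bool" where
  "solution \<kappa>a \<kappa>b a b \<longleftrightarrow>
     C2 a \<and> C2 b \<and>
     (\<forall>t. \<bar>deriv a t\<bar> < 1 \<and> \<bar>deriv b t\<bar> < 1 \<and> a t > b t) \<and>
     all_light_times_exist a b \<and>
     (\<forall>t. ((\<lambda>s. deriv a s / sqrt (1 - (deriv a s)\<^sup>2)) has_real_derivative
        \<kappa>a / 2 *
          (rho (deriv b (t2_ret a b t)) / (a t - b (t2_ret a b t))\<^sup>2 +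
           sigma (deriv b (t2_adv a b t)) / (a t - b (t2_adv a b t))\<^sup>2)) (at t)) \<and>
     (\<forall>t. ((\<lambda>s. deriv b s / sqrt (1 - (deriv b s)\<^sup>2)) has_real_derivative
        - (\<kappa>b / 2) *
          (sigma (deriv a (t1_ret a b t)) / (b t - a (t1_ret a b t))\<^sup>2 +
           rho (deriv a (t1_adv a b t)) / (b t - a (t1_adv a b t))\<^sup>2)) (at t))"

end

theory Submission
  imports Defs
begin

text \<open>
  Follow a light ray zigzagging between the two world lines, through the times
  \<open>T1m < T2m < T1p < T2p\<close>. For \<open>u\<close> between \<open>T2m\<close> and \<open>T2p\<close> the equation of motion of \<open>b\<close> has
  known left-hand side and known retarded term, so it determines
  \<open>rho (deriv a (S u)) / (S u - u)\<^sup>2\<close>, where \<open>S u\<close> is the advanced time. Since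
  \<open>deriv S u = (1 - deriv b u) / (1 - deriv a (S u))\<close> and \<open>1 / (1 - v) = (1 + rho v) / 2\<close>, this is an
  explicit scalar ODE for \<open>S\<close> with known coefficients and initial value \<open>T1p\<close>. Hence \<open>S\<close>, and with
  it \<open>a\<close> up to the next vertex of the zigzag, is determined. The reflection \<open>(a, b) \<mapsto> (- b, - a)\<close>
  exchanges the particles, so the argument continues alternately. A bounded zigzag would converge
  to a collision \<open>a = b\<close>, so the whole future is reached; time reversal gives the past.
\<close>

text \<open>
  The notion of solution with explicit velocities, and with the light times given by relations
  instead of descriptions. The absolute values can be dropped because of \<open>b t < a t\<close>
  and subluminality.
\<close>
definition orbits ::
    "real \<Rightarrow> real \<Rightarrow> (real \<Rightarrow> real) \<Rightarrow> (real \<Rightarrow> real) \<Rightarrow> (real \<Rightarrow> real) \<Rightarrow> (real \<Rightarrow> real) \<Rightarrow> bool" where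
  "orbits \<kappa>a \<kappa>b a va b vb \<longleftrightarrow>
     (\<forall>t. (a has_real_derivative va t) (at t)) \<and> (\<forall>t. (b has_real_derivative vb t) (at t)) \<and>
     continuous_on UNIV va \<and> continuous_on UNIV vb \<and>
     (\<forall>t. \<bar>va t\<bar> < 1) \<and> (\<forall>t. \<bar>vb t\<bar> < 1) \<and> (\<forall>t. b t < a t) \<and>
     (\<forall>t. \<exists>s. s - t = a s - b t) \<and> (\<forall>t. \<exists>s. t - s = a s - b t) \<and>
     (\<forall>t. \<exists>s. s - t = a t - b s) \<and> (\<forall>t. \<exists>s. t - s = a t - b s) \<and>
     (\<forall>t r s. t - r = a t - b r \<longrightarrow> s - t = a t - b s \<longrightarrow>
        ((\<lambda>u. va u / sqrt (1 - (va u)\<^sup>2)) has_real_derivative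
          \<kappa>a / 2 * (rho (vb r) / (t - r)\<^sup>2 + sigma (vb s) / (s - t)\<^sup>2)) (at t)) \<and>
     (\<forall>t r s. t - r = a r - b t \<longrightarrow> s - t = a s - b t \<longrightarrow>
        ((\<lambda>u. vb u / sqrt (1 - (vb u)\<^sup>2)) has_real_derivative
          - (\<kappa>b / 2) * (sigma (va r) / (t - r)\<^sup>2 + rho (va s) / (s - t)\<^sup>2)) (at t))"

section \<open>Subluminal curves\<close>

lemma subluminal:
  fixes f v :: "real \<Rightarrow> real"
  assumes "\<And>t. (f has_real_derivative v t) (at t)" and "\<And>t. \<bar>v t\<bar> < 1" and "s \<noteq> t"
  shows "\<bar>f s - f t\<bar> < \<bar>s - t\<bar>"
proof -
  have *: "\<bar>f y - f x\<bar> < \<bar>y - x\<bar>" if xy: "x < y" for x y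
  proof -
    obtain z where "f y - f x = (y - x) * v z"
      using MVT2[OF xy, of f v, OF assms(1)] by blast
    then show ?thesis
      using assms(2)[of z] xy by (simp add: abs_mult)
  qed
  show ?thesis
    using *[of s t] *[of t s] assms(3) by (cases "s < t") (auto simp: abs_minus_commute)
qed

text \<open>The null coordinates \<open>s + f s\<close> and \<open>s - f s\<close> increase strictly
  along a subluminal curve. They are constant along light rays, so light times can be ordered by
  comparing them.\<close>

lemma subluminal_mono:
  fixes f v :: "real \<Rightarrow> real"
  assumes "\<And>t. (f has_real_derivative v t) (at t)" and "\<And>t. \<bar>v t\<bar> < 1"
  shows "s + f s < t + f t \<longleftrightarrow> s < t" and "s - f s < t - f t \<longleftrightarrow> s < t"
  using subluminal[OF assms, of s t] by (atomize (full), cases "s = t") auto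

section \<open>Symmetries of the system\<close>

text \<open>Spatial reflection swaps right and left particle, and \<open>rho (- v) = sigma v\<close>
  swaps the two force factors. Results about the upper curve thereby transfer to the lower
  one.\<close>

lemma orbits_mirror:
  assumes "orbits \<kappa>a \<kappa>b a va b vb"
  shows "orbits \<kappa>b \<kappa>a (\<lambda>t. - b t) (\<lambda>t. - vb t) (\<lambda>t. - a t) (\<lambda>t. - va t)"
proof -
  have rs: "rho (- v) = sigma v" "sigma (- v) = rho v" for v
    by (simp_all add: rho_def sigma_def)
  have m: "((\<lambda>u. - g u / sqrt (1 - (- g u)\<^sup>2)) has_real_derivative D) (at t)"
    if "((\<lambda>u. g u / sqrt (1 - (g u)\<^sup>2)) has_real_derivative - D) (at t)" for g D and t :: real
    using DERIV_minus[OF that] by simp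
  show ?thesis
    using assms unfolding orbits_def rs
    by (intro conjI allI impI m)
      (auto intro!: DERIV_minus continuous_intros simp: algebra_simps)
qed

text \<open>Time reversal is combined with reflection: velocities keep their sign, so
  \<open>rho\<close> and \<open>sigma\<close> stay in place while retarded and advanced times trade
  roles. The particles are exchanged, so a zigzag ending on \<open>b\<close> becomes one that starts
  on the new upper curve.\<close>

lemma orbits_reverse:
  assumes "orbits \<kappa>a \<kappa>b a va b vb"
  shows "orbits \<kappa>b \<kappa>a (\<lambda>t. - b (- t)) (\<lambda>t. vb (- t)) (\<lambda>t. - a (- t)) (\<lambda>t. va (- t))"
proof -
  have m: "((\<lambda>u. g (- u)) has_real_derivative D) (at t)"
    if "(g has_real_derivative - D) (at (- t))" for g D and t :: real
    using that by (simp add: DERIV_mirror)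
  have n: "((\<lambda>u. - g (- u)) has_real_derivative D) (at t)"
    if "(g has_real_derivative D) (at (- t))" for g D and t :: real
    using DERIV_minus[OF m[of g "- D" t]] that by simp
  have cc: "continuous_on UNIV (\<lambda>t. g (- t))" if "continuous_on UNIV g" for g :: "real \<Rightarrow> real"
    by (rule continuous_on_compose2[OF that]) (auto intro: continuous_intros)
  have da: "\<And>t. (a has_real_derivative va t) (at t)" and db: "\<And>t. (b has_real_derivative vb t) (at t)"
    and cv: "continuous_on UNIV va" "continuous_on UNIV vb"
    and va: "\<And>t. \<bar>va t\<bar> < 1" and vb: "\<And>t. \<bar>vb t\<bar> < 1" and ba: "\<And>t. b t < a t"
    and t1: "\<And>t. \<exists>s. s - t = a s - b t" "\<And>t. \<exists>s. t - s = a s - b t"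
    and t2: "\<And>t. \<exists>s. s - t = a t - b s" "\<And>t. \<exists>s. t - s = a t - b s"
    and ea: "\<And>t r s. t - r = a t - b r \<Longrightarrow> s - t = a t - b s \<Longrightarrow>
        ((\<lambda>u. va u / sqrt (1 - (va u)\<^sup>2)) has_real_derivative
          \<kappa>a / 2 * (rho (vb r) / (t - r)\<^sup>2 + sigma (vb s) / (s - t)\<^sup>2)) (at t)"
    and eb: "\<And>t r s. t - r = a r - b t \<Longrightarrow> s - t = a s - b t \<Longrightarrow>
        ((\<lambda>u. vb u / sqrt (1 - (vb u)\<^sup>2)) has_real_derivative
          - (\<kappa>b / 2) * (sigma (va r) / (t - r)\<^sup>2 + rho (va s) / (s - t)\<^sup>2)) (at t)"
    using assms unfolding orbits_def by auto
  have ex: "\<exists>s. P s" if "\<exists>s. Q s" and "\<And>s. Q s \<Longrightarrow> P (- s)" for P Q :: "real \<Rightarrow> bool"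
    using that by blast
  have t1': "\<exists>s. s - t = - b (- s) - - a (- t)" "\<exists>s. t - s = - b (- s) - - a (- t)" for t
    by (rule ex[OF t2(2)[of "- t"]], simp) (rule ex[OF t2(1)[of "- t"]], simp)
  have t2': "\<exists>s. s - t = - b (- t) - - a (- s)" "\<exists>s. t - s = - b (- t) - - a (- s)" for t
    by (rule ex[OF t1(2)[of "- t"]], simp) (rule ex[OF t1(1)[of "- t"]], simp)
  have eA: "((\<lambda>u. vb (- u) / sqrt (1 - (vb (- u))\<^sup>2)) has_real_derivative
      \<kappa>b / 2 * (rho (va (- r)) / (t - r)\<^sup>2 + sigma (va (- s)) / (s - t)\<^sup>2)) (at t)"
    if "t - r = - b (- t) - - a (- r)" and "s - t = - b (- t) - - a (- s)" for t r s
  proof (rule m[where g = "\<lambda>u. vb u / sqrt (1 - (vb u)\<^sup>2)"], rule DERIV_cong[OF eb])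
    show "- t - (- s) = a (- s) - b (- t)" and "- r - (- t) = a (- r) - b (- t)"
      using that by simp_all
  qed (simp add: algebra_simps)
  have eB: "((\<lambda>u. va (- u) / sqrt (1 - (va (- u))\<^sup>2)) has_real_derivative
      - (\<kappa>a / 2) * (sigma (vb (- r)) / (t - r)\<^sup>2 + rho (vb (- s)) / (s - t)\<^sup>2)) (at t)"
    if "t - r = - b (- r) - - a (- t)" and "s - t = - b (- s) - - a (- t)" for t r s
  proof (rule m[where g = "\<lambda>u. va u / sqrt (1 - (va u)\<^sup>2)"], rule DERIV_cong[OF ea])
    show "- t - (- s) = a (- t) - b (- s)" and "- r - (- t) = a (- t) - b (- r)"
      using that by simp_all
  qed (simp add: algebra_simps)
  show ?thesis
    unfolding orbits_def
    by (intro conjI allI impI n da db cc cv va vb t1' t2' eA eB) (simp_all add: ba)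
qed

section \<open>Calculus tools\<close>

lemma deriv_agree:
  fixes f g :: "real \<Rightarrow> real"
  assumes "(f has_real_derivative D) (at t)" and "(g has_real_derivative E) (at t)"
    and "x < t" and "t < y" and "\<And>u. x < u \<Longrightarrow> u < y \<Longrightarrow> g u = f u"
  shows "E = D"
proof -
  have "(f has_real_derivative E) (at t)"
    by (rule has_field_derivative_transform_within_open[OF assms(2), of "{x<..<y}"])
      (use assms(3-5) in auto)
  then show ?thesis
    using DERIV_unique assms(1) by blast
qed

text \<open>A Gronwall argument: if \<open>M\<close> bounds the absolute value of \<open>H\<close>,
  then \<open>(d u)\<^sup>2 * exp (- (2 * M * u))\<close> is nonincreasing; it is nonnegative and
  starts at 0.\<close>

lemma linear_ode_zero:
  fixes d H :: "real \<Rightarrow> real"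
  assumes "continuous_on {x..z} d" and "d x = 0" and "continuous_on {x..z} H"
    and "\<And>u. x < u \<Longrightarrow> u < z \<Longrightarrow> (d has_real_derivative H u * d u) (at u)"
    and "u \<in> {x..z}"
  shows "d u = 0"
proof -
  have "bounded (H ` {x..z})"
    using assms(3) compact_continuous_image compact_imp_bounded by blast
  then obtain M where M: "\<And>u. u \<in> {x..z} \<Longrightarrow> \<bar>H u\<bar> \<le> M"
    unfolding bounded_iff by (metis image_eqI real_norm_def)
  let ?e = "\<lambda>u. (d u)\<^sup>2 * exp (- (2 * M * u))"
  have "?e u \<le> ?e x"
  proof (rule DERIV_nonpos_imp_decreasing_open[of x u ?e])
    show "x \<le> u" using assms(5) by simp
    show "continuous_on {x..u} ?e"
      using assms(5) by (intro continuous_intros continuous_on_subset[OF assms(1)]) auto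
    fix s assume s: "x < s" "s < u"
    have "(?e has_real_derivative 2 * (H s - M) * ((d s)\<^sup>2 * exp (- (2 * M * s)))) (at s)"
      using s assms(5)
      by (auto intro!: derivative_eq_intros assms(4) simp: power2_eq_square algebra_simps)
    moreover have "2 * (H s - M) * ((d s)\<^sup>2 * exp (- (2 * M * s))) \<le> 0"
      using M[of s] s assms(5) by (intro mult_nonpos_nonneg[of "2 * _"]) auto
    ultimately show "\<exists>y. (?e has_real_derivative y) (at s) \<and> y \<le> 0" by blast
  qed
  then show ?thesis
    using assms(2) by (simp add: mult_le_0_iff not_le)
qed

section \<open>Advanced times and one step of the zigzag\<close>

lemma light_order:
  assumes "orbits \<kappa>a \<kappa>b a va b vb"
  shows "t - s = a s - b t \<Longrightarrow> s < t" and "s - t = a s - b t \<Longrightarrow> t < s"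
proof -
  have da: "\<And>t. (a has_real_derivative va t) (at t)" and va: "\<And>t. \<bar>va t\<bar> < 1" and ba: "b t < a t"
    using assms unfolding orbits_def by auto
  show "s < t" if "t - s = a s - b t"
    using subluminal_mono(1)[OF da va, of s t] that ba by linarith
  show "t < s" if "s - t = a s - b t"
    using subluminal_mono(2)[OF da va, of t s] that ba by linarith
qed

text \<open>The light cone condition reads \<open>S u - a (S u) = u - b u\<close>. Hence
  \<open>S\<close> is the inverse of the injective map \<open>s - a s\<close> composed with
  \<open>u - b u\<close>, and the inverse function theorem yields its derivative.\<close>

lemma advanced_time:
  assumes O: "orbits \<kappa>a \<kappa>b a va b vb"
  obtains S where "\<And>u. S u - u = a (S u) - b u" and "\<And>u. u < S u"
    and "\<And>u. (S has_real_derivative (1 - vb u) / (1 - va (S u))) (at u)"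
    and "\<And>u s. s - u = a s - b u \<Longrightarrow> s = S u"
proof -
  have da: "\<And>t. (a has_real_derivative va t) (at t)" and db: "\<And>t. (b has_real_derivative vb t) (at t)"
    and va: "\<And>t. \<bar>va t\<bar> < 1" and vb: "\<And>t. \<bar>vb t\<bar> < 1" and ba: "\<And>t. b t < a t"
    and ex: "\<forall>t. \<exists>s. s - t = a s - b t"
    using O unfolding orbits_def by auto
  obtain S where S: "\<And>u. S u - u = a (S u) - b u"
    using ex by metis
  let ?F = "\<lambda>s. s - a s"
  have inj: "inj ?F"
    by (rule injI) (metis subluminal_mono(2)[OF da va] linorder_neqE order_less_irrefl)
  have "isCont ?F s" for s
    by (intro continuous_intros DERIV_isCont[OF da])
  then have cF: "continuous_on UNIV ?F"
    by (simp add: continuous_on_eq_continuous_at)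
  have FS: "S u - a (S u) = u - b u" for u
    using S[of u] by linarith
  have S_inv: "S u = inv ?F (u - b u)" for u
    using inv_f_f[OF inj, of "S u"] FS by simp
  show thesis
  proof
    show "S u - u = a (S u) - b u" for u by (rule S)
    show "u < S u" for u
      using light_order(2)[OF O S] .
    show "s = S u" if "s - u = a s - b u" for u s
      using that S[of u] injD[OF inj, of s "S u"] by linarith
    show "(S has_real_derivative (1 - vb u) / (1 - va (S u))) (at u)" for u
    proof -
      have "(inv ?F has_real_derivative inverse (1 - va (S u))) (at (?F (S u)))"
        unfolding has_field_derivative_def
      proof (rule has_derivative_inverse_strong[OF open_UNIV UNIV_I cF])
        show "(?F has_derivative (*) (1 - va (S u))) (at (S u))"
          using DERIV_diff[OF DERIV_ident da] unfolding has_field_derivative_def .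
        show "(*) (1 - va (S u)) \<circ> (*) (inverse (1 - va (S u))) = id"
          using va[of "S u"] by auto
      qed (rule inv_f_f[OF inj])
      moreover have "((\<lambda>u. u - b u) has_real_derivative 1 - vb u) (at u)"
        by (auto intro!: derivative_eq_intros db)
      ultimately have
        "((\<lambda>u. inv ?F (u - b u)) has_real_derivative inverse (1 - va (S u)) * (1 - vb u)) (at u)"
        unfolding FS by (rule DERIV_chain2)
      then show ?thesis
        by (simp add: S_inv[symmetric] field_simps)
    qed
  qed
qed

text \<open>The vertices \<open>w\<close>, \<open>y\<close>, \<open>v\<close> lie on
  \<open>a\<close> and \<open>x\<close>, \<open>z\<close> on \<open>b\<close>. As \<open>u\<close>
  runs from \<open>x\<close> to \<open>z\<close>, its retarded time runs through the known strip
  from \<open>w\<close> to \<open>y\<close>, and its advanced time through the new strip from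
  \<open>y\<close> to \<open>v\<close>.\<close>

lemma advance_upper:
  assumes O: "orbits \<kappa>a \<kappa>b a va b vb" and O': "orbits \<kappa>a \<kappa>b a' va' b' vb'" and k: "\<kappa>b \<noteq> 0"
    and w: "x - w = a w - b x" and x: "y - x = a y - b x" and y: "z - y = a y - b z"
    and v: "v - z = a v - b z"
    and aa: "\<forall>t\<in>{w..y}. a' t = a t" and bb: "\<forall>t\<in>{x..z}. b' t = b t"
  shows "\<forall>t\<in>{y..v}. a' t = a t"
proof -
  have da: "\<And>t. (a has_real_derivative va t) (at t)" and db: "\<And>t. (b has_real_derivative vb t) (at t)"
    and va: "\<And>t. \<bar>va t\<bar> < 1" and vb: "\<And>t. \<bar>vb t\<bar> < 1" and ba: "\<And>t. b t < a t"
    and cva: "continuous_on UNIV va" and cvb: "continuous_on UNIV vb"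
    and ret: "\<And>t. \<exists>s. t - s = a s - b t"
    and eq: "\<And>t r s. t - r = a r - b t \<Longrightarrow> s - t = a s - b t \<Longrightarrow>
        ((\<lambda>u. vb u / sqrt (1 - (vb u)\<^sup>2)) has_real_derivative
          - (\<kappa>b / 2) * (sigma (va r) / (t - r)\<^sup>2 + rho (va s) / (s - t)\<^sup>2)) (at t)"
    using O unfolding orbits_def by auto
  have da': "\<And>t. (a' has_real_derivative va' t) (at t)" and db': "\<And>t. (b' has_real_derivative vb' t) (at t)"
    and va': "\<And>t. \<bar>va' t\<bar> < 1"
    and eq': "\<And>t r s. t - r = a' r - b' t \<Longrightarrow> s - t = a' s - b' t \<Longrightarrow>
        ((\<lambda>u. vb' u / sqrt (1 - (vb' u)\<^sup>2)) has_real_derivative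
          - (\<kappa>b / 2) * (sigma (va' r) / (t - r)\<^sup>2 + rho (va' s) / (s - t)\<^sup>2)) (at t)"
    using O' unfolding orbits_def by auto
  obtain S where S: "\<And>u. S u - u = a (S u) - b u" and Sgt: "\<And>u. u < S u"
    and dS: "\<And>u. (S has_real_derivative (1 - vb u) / (1 - va (S u))) (at u)"
    and Su: "\<And>u s. s - u = a s - b u \<Longrightarrow> s = S u"
    using advanced_time[OF O] by blast
  obtain S' where S': "\<And>u. S' u - u = a' (S' u) - b' u" and Sgt': "\<And>u. u < S' u"
    and dS': "\<And>u. (S' has_real_derivative (1 - vb' u) / (1 - va' (S' u))) (at u)"
    and Su': "\<And>u s. s - u = a' s - b' u \<Longrightarrow> s = S' u"
    using advanced_time[OF O'] by blast
  have Sx: "S x = y" and Sz: "S z = v" using Su x v by auto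
  have wx: "w < x" and xy: "x < y" and yz: "y < z"
    using light_order[OF O] w x y by blast+
  \<comment> \<open>Both ends of this ray lie in the known strips, so the two advanced times have
    the same initial value.\<close>
  have Sx': "S' x = y" using Su'[of y x] x aa bb wx xy yz by simp
  have cS: "continuous_on T S" and cS': "continuous_on T S'" for T
    using dS dS' DERIV_isCont continuous_at_imp_continuous_on by blast+
  \<comment> \<open>The ODE for \<open>S\<close> is quadratic in \<open>S u - u\<close>, so the difference of two solutions obeys a linear one.\<close>
  let ?H = "\<lambda>u. (1 - vb u) / 2 * (rho (va (S u)) / (S u - u)\<^sup>2) * (S u + S' u - 2 * u)"
  have nz: "1 - va t \<noteq> 0" "S u - u \<noteq> 0" for t u
    using va[of t] Sgt[of u] by auto
  have cH: "continuous_on {x..z} ?H"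
    unfolding rho_def
    by (intro continuous_intros cS cS' continuous_on_compose2[OF cva] continuous_on_subset[OF cvb])
       (use nz in auto)
  have ode: "((\<lambda>u. S u - S' u) has_real_derivative ?H u * (S u - S' u)) (at u)" if u: "x < u" "u < z" for u
  proof -
    \<comment> \<open>Agreement on a strip fixes velocities only in its interior, hence the open
      intervals here.\<close>
    have vbu: "vb' t = vb t" if "x < t" "t < z" for t
      by (rule deriv_agree[OF db db', of x t z]) (use that bb in auto)
    obtain r where r: "u - r = a r - b u" using ret by blast
    \<comment> \<open>Along the rays \<open>w + a w = x + b x\<close>,
      \<open>r + a r = u + b u\<close> and \<open>y + a y = z + b z\<close>, so the order of
      \<open>x\<close>, \<open>u\<close>, \<open>z\<close> passes to \<open>w\<close>,
      \<open>r\<close>, \<open>y\<close>.\<close>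
    have "w + a w < r + a r" "r + a r < y + a y"
      using subluminal_mono(1)[OF db vb, of x u] subluminal_mono(1)[OF db vb, of u z] r w y u by linarith+
    then have wr: "w < r" "r < y" using subluminal_mono(1)[OF da va] by auto
    have var: "va' r = va r"
      by (rule deriv_agree[OF da da', of w r y]) (use wr aa in auto)
    have r': "u - r = a' r - b' u" using r aa bb wr u by simp
    \<comment> \<open>Both sides are the derivative of the momentum of \<open>b\<close>, which is
      the same function for both solutions between \<open>x\<close> and \<open>z\<close>.\<close>
    have "- (\<kappa>b / 2) * (sigma (va' r) / (u - r)\<^sup>2 + rho (va' (S' u)) / (S' u - u)\<^sup>2)
        = - (\<kappa>b / 2) * (sigma (va r) / (u - r)\<^sup>2 + rho (va (S u)) / (S u - u)\<^sup>2)"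
      by (rule deriv_agree[OF eq[OF r S] eq'[OF r' S'], of x z]) (use u vbu in auto)
    then have G: "rho (va' (S' u)) / (S' u - u)\<^sup>2 = rho (va (S u)) / (S u - u)\<^sup>2"
      using k var by simp
    \<comment> \<open>With the common coefficient \<open>g\<close>, the slopes of \<open>S\<close>
      and \<open>S'\<close> are the same quadratic expression, evaluated at \<open>S u - u\<close>
      and \<open>S' u - u\<close>.\<close>
    define g where "g = rho (va (S u)) / (S u - u)\<^sup>2"
    have g1: "rho (va (S u)) = g * (S u - u)\<^sup>2" unfolding g_def using Sgt[of u] by simp
    have g2: "rho (va' (S' u)) = g * (S' u - u)\<^sup>2" unfolding g_def G[symmetric] using Sgt'[of u] by simp
    have i1: "1 / (1 - va (S u)) = (1 + g * (S u - u)\<^sup>2) / 2"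
      unfolding g1[symmetric] rho_def using va[of "S u"] by (simp add: field_simps)
    have i2: "1 / (1 - va' (S' u)) = (1 + g * (S' u - u)\<^sup>2) / 2"
      unfolding g2[symmetric] rho_def using va'[of "S' u"] by (simp add: field_simps)
    have "(1 - vb u) / (1 - va (S u)) - (1 - vb' u) / (1 - va' (S' u))
        = (1 - vb u) * (1 / (1 - va (S u))) - (1 - vb u) * (1 / (1 - va' (S' u)))"
      using vbu u by simp
    also have "\<dots> = (1 - vb u) / 2 * g * (S u + S' u - 2 * u) * (S u - S' u)"
      unfolding i1 i2 by (simp add: field_simps power2_eq_square)
    finally show ?thesis
      using DERIV_diff[OF dS[of u] dS'[of u]] by (simp add: g_def)
  qed
  have SS: "S u = S' u" if "u \<in> {x..z}" for u
    using linear_ode_zero[of x z "\<lambda>u. S u - S' u", OF _ _ cH ode that] Sx Sx'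
    by (simp add: cS cS' continuous_on_diff)
  show ?thesis
  proof
    fix t assume "t \<in> {y..v}"
    \<comment> \<open>Every \<open>t\<close> in the new strip is an advanced time
      \<open>S u\<close>, and the ray from \<open>u\<close> gives \<open>a t = t - u + b u\<close>,
      which involves only known data.\<close>
    then obtain u where u: "x \<le> u" "u \<le> z" "S u = t"
      using IVT'[of S x t z] Sx Sz xy yz cS by auto
    then show "a' t = a t" using S[of u] S'[of u] SS[of u] bb by auto
  qed
qed

section \<open>Propagation along the whole zigzag\<close>

lemma agree_future:
  assumes O: "orbits \<kappa>a \<kappa>b a va b vb" and O': "orbits \<kappa>a \<kappa>b a' va' b' vb'"
    and ka: "\<kappa>a \<noteq> 0" and kb: "\<kappa>b \<noteq> 0"
    and w: "x - w = a w - b x" and x: "y - x = a y - b x" and y: "z - y = a y - b z"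
    and aa: "\<forall>t\<in>{w..y}. a' t = a t" and bb: "\<forall>t\<in>{x..z}. b' t = b t"
  shows "\<forall>t\<ge>w. a' t = a t" and "\<forall>t\<ge>x. b' t = b t"
proof -
  note M = orbits_mirror[OF O] and M' = orbits_mirror[OF O']
  obtain f where f: "\<And>u. f u - u = a (f u) - b u" and f_gt: "\<And>u. u < f u"
    and fu: "\<And>u s. s - u = a s - b u \<Longrightarrow> s = f u"
    using advanced_time[OF O] by metis
  obtain g where g0: "\<And>u. g u - u = - b (g u) - - a u" and g_gt: "\<And>u. u < g u"
    and gu: "\<And>u s. s - u = - b s - - a u \<Longrightarrow> s = g u"
    using advanced_time[OF M] by metis
  have g: "g u - u = a u - b (g u)" for u using g0[of u] by simp
  \<comment> \<open>The zigzag vertices: \<open>r n\<close> on \<open>a\<close> and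
    \<open>s n\<close> on \<open>b\<close>; \<open>g\<close> follows a ray from \<open>a\<close> to
    \<open>b\<close>, and \<open>f\<close> one back to \<open>a\<close>.\<close>
  define r where "r n = ((f \<circ> g) ^^ n) w" for n
  define s where "s n = g (r n)" for n
  have r_0: "r 0 = w" and r_Suc: "r (Suc n) = f (s n)" for n
    by (simp_all add: r_def s_def)
  have xyz: "s 0 = x" "r (Suc 0) = y" "s (Suc 0) = z"
    using gu[of x w] fu[of y x] gu[of z y] w x y by (simp_all add: s_def r_0 r_Suc)
  have rs: "r n < s n" and sr: "s n < r (Suc n)" for n
    unfolding r_Suc using g_gt f_gt by (simp_all add: s_def)
  have agree: "(\<forall>t\<in>{r n..r (Suc n)}. a' t = a t) \<and> (\<forall>t\<in>{s n..s (Suc n)}. b' t = b t)" for n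
  proof (induction n)
    case 0
    then show ?case using aa bb xyz r_0 by simp
  next
    case (Suc n)
    have A: "\<forall>t\<in>{r (Suc n)..r (Suc (Suc n))}. a' t = a t"
      by (rule advance_upper[OF O O' kb, of "s n" "r n" _ "s (Suc n)"])
        (use Suc g f in \<open>auto simp: s_def r_Suc\<close>)
    \<comment> \<open>The same step for the mirrored system, with the strip of \<open>a\<close> just
      gained in \<open>A\<close> as input.\<close>
    have "\<forall>t\<in>{s (Suc n)..s (Suc (Suc n))}. - b' t = - b t"
      by (rule advance_upper[OF M M' ka, of "r (Suc n)" "s n" _ "r (Suc (Suc n))"])
        (use Suc A f g in \<open>auto simp: s_def r_Suc algebra_simps\<close>)
    with A show ?case by simp
  qed
  have "\<exists>n. t < r n" for t
  proof (rule ccontr)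
    assume "\<nexists>n. t < r n"
    then have "\<bar>r n\<bar> \<le> max \<bar>t\<bar> \<bar>w\<bar>" if "w \<le> r n" for n
      using that by (smt (verit))
    moreover have "incseq r"
      using rs sr by (intro incseq_SucI) (meson less_imp_le less_trans)
    moreover have "w \<le> r n" for n
      using \<open>incseq r\<close> r_0 by (metis incseqD le0)
    ultimately obtain L where L: "r \<longlonglongrightarrow> L"
      using incseq_convergent[of r t] \<open>\<nexists>n. t < r n\<close> by (meson not_le)
    then have "(\<lambda>n. r (Suc n)) \<longlonglongrightarrow> L" by (rule LIMSEQ_Suc)
    then have Ls: "s \<longlonglongrightarrow> L"
      by (rule tendsto_sandwich[OF _ _ L, rotated 2])
        (use rs sr in \<open>auto intro!: always_eventually less_imp_le\<close>)
    have "isCont a L" "isCont b L"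
      using O DERIV_isCont unfolding orbits_def by blast+
    \<comment> \<open>The distance \<open>a (r n) - b (s n)\<close> equals the time difference
      \<open>s n - r n\<close>, which tends to 0 because both sequences tend to
      \<open>L\<close>.\<close>
    then have "(\<lambda>n. a (r n) - b (s n)) \<longlonglongrightarrow> a L - b L"
      using L Ls by (intro tendsto_diff isCont_tendsto_compose[of _ a] isCont_tendsto_compose[of _ b])
    moreover have "(\<lambda>n. a (r n) - b (s n)) \<longlonglongrightarrow> L - L"
      using tendsto_diff[OF Ls L] g by (simp add: s_def)
    ultimately have "a L - b L = L - L" by (rule LIMSEQ_unique)
    moreover have "b L < a L" using O unfolding orbits_def by blast
    ultimately show False by simp
  qed
  then have ub: "\<exists>n. t < r n" "\<exists>n. t < s n" for t
    using rs less_trans by blast+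
  \<comment> \<open>The least index with \<open>t < q n\<close> is positive because
    \<open>q 0 \<le> t\<close>; its predecessor starts the required interval.\<close>
  have cover: "\<exists>n. q n \<le> t \<and> t < q (Suc n)" if q: "q 0 \<le> t" "\<exists>n. t < q n" for q :: "nat \<Rightarrow> real" and t
  proof -
    obtain n where "t < q n" "\<forall>m<n. \<not> t < q m"
      using q(2) exists_least_iff[of "\<lambda>n. t < q n"] by blast
    then show ?thesis using q(1) by (cases n) (auto simp: not_less)
  qed
  show "\<forall>t\<ge>w. a' t = a t"
    using cover[OF _ ub(1)] agree r_0 by (metis atLeastAtMost_iff less_imp_le)
  show "\<forall>t\<ge>x. b' t = b t"
    using cover[OF _ ub(2)] agree xyz(1) by (metis atLeastAtMost_iff less_imp_le)
qed

lemma agree_everywhere: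
  assumes O: "orbits \<kappa>a \<kappa>b a va b vb" and O': "orbits \<kappa>a \<kappa>b a' va' b' vb'"
    and ka: "\<kappa>a \<noteq> 0" and kb: "\<kappa>b \<noteq> 0"
    and w: "x - w = a w - b x" and x: "y - x = a y - b x" and y: "z - y = a y - b z"
    and aa: "\<forall>t\<in>{w..y}. a' t = a t" and bb: "\<forall>t\<in>{x..z}. b' t = b t"
  shows "a' = a" and "b' = b"
proof -
  note future = agree_future[OF O O' ka kb w x y aa bb]
  \<comment> \<open>The reversed zigzag has vertices \<open>- z\<close>, \<open>- y\<close>,
    \<open>- x\<close>, \<open>- w\<close>, beginning on the upper curve
    \<open>- b (- t)\<close>.\<close>
  note past = agree_future[OF orbits_reverse[OF O] orbits_reverse[OF O'] kb ka, of "- y" "- z" "- x" "- w"]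
  have "\<forall>t\<ge>- z. - b' (- t) = - b (- t)" and "\<forall>t\<ge>- y. - a' (- t) = - a (- t)"
    by (rule past; use w x y aa bb in auto)+
  then have "\<forall>t\<le>z. b' t = b t" and "\<forall>t\<le>y. a' t = a t"
    by (metis add.inverse_inverse neg_le_iff_le)+
  moreover have "w \<le> y" and "x \<le> z"
    using light_order[OF O] w x y by (meson less_imp_le less_trans)+
  ultimately have "a' t = a t" and "b' t = b t" for t
    using future by (meson linear order_trans)+
  then show "a' = a" and "b' = b" by auto
qed

section \<open>From solutions with implicit light times to orbits\<close>

text \<open>If \<open>f s\<close> lay below \<open>c\<close>, then \<open>f\<close> would travel
  more than \<open>\<bar>s - t\<bar>\<close> between \<open>s\<close> and \<open>t\<close>, against
  subluminality. So the absolute value opens with a positive sign.\<close>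

lemma light_time_iff:
  fixes f v :: "real \<Rightarrow> real"
  assumes "\<And>t. (f has_real_derivative v t) (at t)" and "\<And>t. \<bar>v t\<bar> < 1" and "c < f t"
  shows "s = t + \<bar>f s - c\<bar> \<longleftrightarrow> s - t = f s - c" and "s = t - \<bar>f s - c\<bar> \<longleftrightarrow> t - s = f s - c"
  using subluminal[OF assms(1,2), where s = s and t = t] assms(3) by (cases "s = t"; linarith)+

text \<open>Two different solutions would be points of the curve joined by a light ray, which
  subluminality forbids; so \<open>THE\<close> returns the given one.\<close>

lemma light_time_unique:
  fixes f v :: "real \<Rightarrow> real"
  assumes "\<And>t. (f has_real_derivative v t) (at t)" and "\<And>t. \<bar>v t\<bar> < 1" and "c < f t"
  shows "s - t = f s - c \<Longrightarrow> (THE s. s = t + \<bar>f s - c\<bar>) = s"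
    and "t - s = f s - c \<Longrightarrow> (THE s. s = t - \<bar>f s - c\<bar>) = s"
proof -
  have "s' = s" if "s' - s = f s' - f s \<or> s - s' = f s' - f s" for s s'
    using subluminal[OF assms(1,2), of s' s] that by (cases "s' = s") auto
  then show "s - t = f s - c \<Longrightarrow> (THE s. s = t + \<bar>f s - c\<bar>) = s"
    and "t - s = f s - c \<Longrightarrow> (THE s. s = t - \<bar>f s - c\<bar>) = s"
    unfolding light_time_iff[where f = f and v = v, OF assms]
    by (intro the_equality; smt (verit))+
qed

lemma C2_deriv:
  assumes "C2 f"
  shows "(f has_real_derivative deriv f t) (at t)" and "continuous_on UNIV (deriv f)"
proof -
  have "f differentiable at t"
    using assms by (auto simp: C2_def C1_differentiable_on_eq)
  then show "(f has_real_derivative deriv f t) (at t)"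
    by (metis DERIV_imp_deriv real_differentiable_def)
  have "deriv f differentiable at u" for u
    using assms by (auto simp: C2_def C1_differentiable_on_eq)
  then show "continuous_on UNIV (deriv f)"
    by (simp add: continuous_at_imp_continuous_on differentiable_imp_continuous_within)
qed

lemma solution_kinematics:
  assumes "solution \<kappa>a \<kappa>b a b"
  shows "(a has_real_derivative deriv a t) (at t)" and "(b has_real_derivative deriv b t) (at t)"
    and "\<bar>deriv a t\<bar> < 1" and "\<bar>deriv b t\<bar> < 1" and "b t < a t"
  using assms C2_deriv(1) unfolding solution_def by blast+

lemma solution_light_times:
  assumes "solution \<kappa>a \<kappa>b a b"
  shows "s - t = a s - b t \<Longrightarrow> t1_adv a b t = s" and "t - s = a s - b t \<Longrightarrow> t1_ret a b t = s"
    and "s - t = a t - b s \<Longrightarrow> t2_adv a b t = s" and "t - s = a t - b s \<Longrightarrow> t2_ret a b t = s"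
    and "\<exists>s. s - t = a s - b t" and "\<exists>s. t - s = a s - b t"
    and "\<exists>s. s - t = a t - b s" and "\<exists>s. t - s = a t - b s"
proof -
  have da: "\<And>t. (a has_real_derivative deriv a t) (at t)"
    and db: "\<And>t. ((\<lambda>t. - b t) has_real_derivative - deriv b t) (at t)"
    and va: "\<And>t. \<bar>deriv a t\<bar> < 1" and vb: "\<And>t. \<bar>- deriv b t\<bar> < 1" and ba: "\<And>t. b t < a t"
    using solution_kinematics[OF assms] by (auto intro: DERIV_minus)
  \<comment> \<open>For the times on \<open>b\<close> the moving point lies below the fixed one, so
    the lemmas are applied to \<open>- b\<close> and \<open>- a t\<close>.\<close>
  have nba: "- a t < - b t" using ba by simp
  note A = light_time_iff[where f = a, OF da va ba] light_time_unique[where f = a, OF da va ba]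
  note B = light_time_iff[where f = "\<lambda>t. - b t", OF db vb nba]
    light_time_unique[where f = "\<lambda>t. - b t", OF db vb nba]
  have *: "\<bar>- b s - - a t\<bar> = \<bar>a t - b s\<bar>" "- b s - - a t = a t - b s" for s t by auto
  show "s - t = a s - b t \<Longrightarrow> t1_adv a b t = s" and "t - s = a s - b t \<Longrightarrow> t1_ret a b t = s"
    and "s - t = a t - b s \<Longrightarrow> t2_adv a b t = s" and "t - s = a t - b s \<Longrightarrow> t2_ret a b t = s"
    using A(3,4) B(3,4)[unfolded *] unfolding t1_adv_def t1_ret_def t2_adv_def t2_ret_def by blast+
  show "\<exists>s. s - t = a s - b t" and "\<exists>s. t - s = a s - b t"
    and "\<exists>s. s - t = a t - b s" and "\<exists>s. t - s = a t - b s"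
    using assms A(1,2) B(1,2)[unfolded *] unfolding solution_def all_light_times_exist_def by metis+
qed

lemma solution_orbits:
  assumes "solution \<kappa>a \<kappa>b a b"
  shows "orbits \<kappa>a \<kappa>b a (deriv a) b (deriv b)"
proof -
  note kin = solution_kinematics[OF assms] and light = solution_light_times[OF assms]
  have C: "continuous_on UNIV (deriv a)" "continuous_on UNIV (deriv b)"
    using assms C2_deriv(2) unfolding solution_def by blast+
  have ea: "((\<lambda>u. deriv a u / sqrt (1 - (deriv a u)\<^sup>2)) has_real_derivative
      \<kappa>a / 2 * (rho (deriv b r) / (t - r)\<^sup>2 + sigma (deriv b s) / (s - t)\<^sup>2)) (at t)"
    if r: "t - r = a t - b r" and s: "s - t = a t - b s" for t r s
  proof -
    have *: "t2_ret a b t = r" "t2_adv a b t = s" using light r s by blast+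
    have "((\<lambda>u. deriv a u / sqrt (1 - (deriv a u)\<^sup>2)) has_real_derivative
      \<kappa>a / 2 * (rho (deriv b (t2_ret a b t)) / (a t - b (t2_ret a b t))\<^sup>2 +
        sigma (deriv b (t2_adv a b t)) / (a t - b (t2_adv a b t))\<^sup>2)) (at t)"
      using assms unfolding solution_def by blast
    then show ?thesis
      \<comment> \<open>On a light ray distance equals elapsed time, which turns the denominators
        into squared time differences.\<close>
      by (simp only: * r s)
  qed
  have eb: "((\<lambda>u. deriv b u / sqrt (1 - (deriv b u)\<^sup>2)) has_real_derivative
      - (\<kappa>b / 2) * (sigma (deriv a r) / (t - r)\<^sup>2 + rho (deriv a s) / (s - t)\<^sup>2)) (at t)"
    if r: "t - r = a r - b t" and s: "s - t = a s - b t" for t r s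
  proof -
    have *: "t1_ret a b t = r" "t1_adv a b t = s" using light r s by blast+
    have "((\<lambda>u. deriv b u / sqrt (1 - (deriv b u)\<^sup>2)) has_real_derivative
      - (\<kappa>b / 2) * (sigma (deriv a (t1_ret a b t)) / (b t - a (t1_ret a b t))\<^sup>2 +
        rho (deriv a (t1_adv a b t)) / (b t - a (t1_adv a b t))\<^sup>2)) (at t)"
      using assms unfolding solution_def by blast
    then show ?thesis
      by (simp only: * r s power2_commute[of "b t"])
  qed
  show ?thesis
    unfolding orbits_def using kin C light(5-8) ea eb by blast
qed

theorem theorem1p4:
  fixes \<kappa>a \<kappa>b :: real
    and a b a' b' :: "real \<Rightarrow> real"
    and T1m T1p T2m T2p :: real
  assumes "\<kappa>a > 0" and "\<kappa>b > 0"
    and "solution \<kappa>a \<kappa>b a b"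
    and "solution \<kappa>a \<kappa>b a' b'"
    and "T2p = t2_adv a b T1p"
    and "T2m = t2_ret a b T1p"
    and "T1m = t1_ret a b T2m"
    and "\<forall>t\<in>{T1m..T1p}. a' t = a t"
    and "\<forall>t\<in>{T2m..T2p}. b' t = b t"
  shows "a' = a \<and> b' = b"
proof -
  note light = solution_light_times[OF assms(3)]
  \<comment> \<open>The times \<open>T1m\<close>, \<open>T2m\<close>, \<open>T1p\<close>,
    \<open>T2p\<close> are the first four vertices \<open>w\<close>, \<open>x\<close>,
    \<open>y\<close>, \<open>z\<close>.\<close>
  have "T2m - T1m = a T1m - b T2m" and "T1p - T2m = a T1p - b T2m" and "T2p - T1p = a T1p - b T2p"
    using light assms(5-7) by metis+
  then show ?thesis
    using agree_everywhere[OF solution_orbits[OF assms(3)] solution_orbits[OF assms(4)]] assms by simp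
qed

end
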